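(* Let $d\geq 1$ be an integer and assume that $N=cn$ with $c,n$ positive integers. For any $x_{1},\dots,x_{N}\in\mathbb{R}^{d}$, there exist disjoint subsets of indices $C_{1},\dots,C_{n}$ of $\{1,\dots,N\}$ such that: (1) $\operatorname{Card}(C_{k})=c$ for all $k=1,\dots,n$; (2) for all $k=1,\dots,n$, $$\operatorname{Diam}\left(x_{(C_{k})}\right)\leq 4r\,k^{-1/d},$$ where $x_{(C_{k})}:=\{x_{i} : i\in C_{k}\}$ and $r=\max_{i=1,\dots,N}\|x_{i}\|$. In particular, there exist $\overline{x}_{1},\dots,\overline{x}_{n}\in\mathbb{R}^{d}$ such that $$\frac{1}{N}\sum_{i=1}^{N}\|x_{i}-\overline{x}_{k(i)}\|\leq 4r\,f_{1,d}(n),$$ where $k(i)\in\{1,\dots,n\}$ is such that $i\in C_{k(i)}$.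
   Context: $\mathbb{R}^{d}$ is equipped with the maximum norm $\|\cdot\|$. For $A\subset\mathbb{R}^{d}$, $\operatorname{Diam}(A):=\sup_{x,y\in A}\|x-y\|$. $\operatorname{Card}(C)$ is the number of elements of a finite set $C$. For integers $d,n\geq 1$, define $f_{1,d}(n):=\frac{d}{d-1}\,n^{-1/d}$ if $d>1$, and $f_{1,1}(n):=\frac{1+\ln n}{n}$ if $d=1$. *)

theory Defs
  imports "HOL-Analysis.Analysis"
begin

(* The norm on real ^ 'd is the library's maximum norm infnorm (see infnorm_cart), not the
   Euclidean norm of the type class.  The library's diameter is Euclidean, hence the following. *)

definition Diam :: "(real ^ 'd) set \<Rightarrow> real" where
  "Diam A = (SUP (x, y) \<in> A \<times> A. infnorm (x - y))"
  \<comment> \<open>a supremum in the reals: meaningful for nonempty bounded \<open>A\<close> only\<close>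

definition f1 :: "nat \<Rightarrow> nat \<Rightarrow> real" where
  "f1 d n = (if d = 1 then (1 + ln (real n)) / real n
             else real d / (real d - 1) * real n powr (- 1 / real d))"

end

theory Submission
  imports Defs
begin

text \<open>The sets are chosen greedily, the last one first.  When \<open>c * k\<close> points of the cube
\<open>[-r, r]\<^sup>d\<close> are left, cut the cube into \<open>m\<^sup>d\<close> congruent cells, where
\<open>m = \<lfloor>k powr (1/d)\<rfloor>\<close>.  Since \<open>m\<^sup>d \<le> k\<close>, some cell contains at least \<open>c\<close> of the points,
and \<open>c\<close> of these form \<open>C k\<close>; as \<open>m \<ge> k powr (1/d) / 2\<close>, the side \<open>2 * r / m\<close> of the cell is
at most \<open>4 * r * k powr (-1/d)\<close> (\<open>exists_small_cluster\<close>).  Removing \<open>C k\<close> leaves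
\<open>c * (k - 1)\<close> points, so that the choice can be repeated down to \<open>k = 1\<close>
(\<open>greedy_disjoint_family\<close>).

The sets then exhaust the indices, because together they have \<open>c * n = N\<close> elements.  If the
centre of each set is one of its own points, each distance to the centre is at most the diameter,
and the mean distance is at most \<open>4 * r / n\<close> times the sum of \<open>k powr (-1/d)\<close> over
\<open>k \<le> n\<close>.  Comparing this sum with the integral of \<open>t powr (-1/d)\<close> gives \<open>f1\<close>.\<close>

section \<open>Selecting disjoint sets greedily\<close>

lemma pigeonhole_fibre_card_ge:
  assumes "finite A" "finite B" "g ` A \<subseteq> B" "c * card B \<le> card A" "B \<noteq> {}"
  shows "\<exists>b\<in>B. c \<le> card {a\<in>A. g a = b}"
proof (rule ccontr)
  assume "\<not> ?thesis"
  then have less: "card {a\<in>A. g a = b} < c" if "b \<in> B" for b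
    using that by (auto simp: not_le)
  have "A = (\<Union>b\<in>B. {a\<in>A. g a = b})"
    using assms(3) by auto
  then have "card A \<le> (\<Sum>b\<in>B. card {a\<in>A. g a = b})"
    using card_UN_le[OF assms(2), of "\<lambda>b. {a\<in>A. g a = b}"] by simp
  also have "\<dots> < (\<Sum>b\<in>B. c)"
    using assms(2,5) less by (intro sum_strict_mono) auto
  finally show False
    using assms(4) by (simp add: mult.commute)
qed

text \<open>The number \<open>k\<close> of the set to be chosen is also the number of sets still missing.
The set chosen first, when most elements are available, therefore has the largest index, which
lets \<open>P k\<close> become more restrictive as \<open>k\<close> grows.\<close>

lemma greedy_disjoint_family:
  fixes c n :: nat
  assumes "\<And>k A. k \<in> {1..n} \<Longrightarrow> A \<subseteq> I \<Longrightarrow> finite A \<Longrightarrow> card A = c * k \<Longrightarrow>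
             \<exists>S\<subseteq>A. card S = c \<and> P k S"
    and "finite I" "card I = c * n"
  shows "\<exists>C. (\<forall>k\<in>{1..n}. C k \<subseteq> I \<and> card (C k) = c \<and> P k (C k)) \<and> disjoint_family_on C {1..n}"
  using assms
proof (induction n arbitrary: I)
  case 0
  then show ?case by (simp add: disjoint_family_on_def)
next
  case (Suc n)
  obtain S where S: "S \<subseteq> I" "card S = c" "P (Suc n) S"
    using Suc.prems(1)[of "Suc n" I] Suc.prems(2,3) by auto
  have card: "card (I - S) = c * n"
    using S Suc.prems by (simp add: card_Diff_subset finite_subset)
  have "\<exists>T\<subseteq>A. card T = c \<and> P k T"
    if "k \<in> {1..n}" "A \<subseteq> I - S" "finite A" "card A = c * k" for k A
    using Suc.prems(1)[of k A] that by auto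
  then obtain C where C: "\<forall>k\<in>{1..n}. C k \<subseteq> I - S \<and> card (C k) = c \<and> P k (C k)"
    "disjoint_family_on C {1..n}"
    using Suc.IH[of "I - S"] card Suc.prems(2) by auto
  show ?case
  proof (intro exI conjI)
    show "\<forall>k\<in>{1..Suc n}. (C(Suc n := S)) k \<subseteq> I \<and> card ((C(Suc n := S)) k) = c
            \<and> P k ((C(Suc n := S)) k)"
      using C(1) S by (auto simp: le_Suc_eq)
    have *: "C k \<inter> S = {}" if "k \<in> {1..n}" for k
      using C(1) that by auto
    show "disjoint_family_on (C(Suc n := S)) {1..Suc n}"
      unfolding disjoint_family_on_def
    proof (intro ballI impI)
      fix k l assume "k \<in> {1..Suc n}" "l \<in> {1..Suc n}" "k \<noteq> l"
      then show "(C(Suc n := S)) k \<inter> (C(Suc n := S)) l = {}"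
        using *[of k] *[of l] disjoint_family_onD[OF C(2), of k l]
        by (cases "k = Suc n"; cases "l = Suc n") auto
    qed
  qed
qed

section \<open>Clusters among points of a cube\<close>

lemma infnorm_le_cart:
  fixes v :: "real ^ 'd"
  assumes "\<And>i. \<bar>v $ i\<bar> \<le> b"
  shows "infnorm v \<le> b"
  unfolding infnorm_cart by (rule cSup_least) (use assms in auto)

lemma interval_partition:
  fixes r :: real and m :: nat
  assumes "r \<ge> 0" "m \<ge> 1"
  obtains g :: "real \<Rightarrow> nat"
  where "\<And>t. g t < m"
    and "\<And>s t. \<bar>s\<bar> \<le> r \<Longrightarrow> \<bar>t\<bar> \<le> r \<Longrightarrow> g s = g t \<Longrightarrow> \<bar>s - t\<bar> \<le> 2 * r / m"
proof (cases "r = 0")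
  case True
  then show ?thesis
    using assms by (intro that[of "\<lambda>_. 0"]) auto
next
  case False
  with assms have r: "r > 0" by simp
  define u where "u t = (t + r) * m / (2 * r)" for t
  \<comment> \<open>The minimum puts the right end point \<open>t = r\<close>, for which \<open>u t = m\<close>, into the last cell.\<close>
  define g where "g t = min (m - 1) (nat \<lfloor>u t\<rfloor>)" for t
  have u: "g t \<le> u t \<and> u t \<le> g t + 1" if "\<bar>t\<bar> \<le> r" for t
  proof -
    have "(t + r) * m \<le> (2 * r) * m"
      using that by (intro mult_right_mono) auto
    then have "0 \<le> u t" "u t \<le> m"
      using that r by (auto simp: u_def divide_simps mult.commute)
    moreover define q where "q = nat \<lfloor>u t\<rfloor>"
    moreover have "real q \<le> u t" "u t \<le> real q + 1"
      using \<open>0 \<le> u t\<close> unfolding q_def by linarith+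
    ultimately show ?thesis
      using assms(2) by (auto simp: g_def q_def[symmetric] min_def of_nat_diff)
  qed
  show ?thesis
  proof (rule that[of g])
    show "g t < m" for t using assms(2) by (auto simp: g_def)
    fix s t assume st: "\<bar>s\<bar> \<le> r" "\<bar>t\<bar> \<le> r" "g s = g t"
    have "\<bar>u s - u t\<bar> \<le> 1"
      using u[OF st(1)] u[OF st(2)] st(3) by auto
    moreover have "s - t = (u s - u t) * (2 * r / m)"
      using r assms(2) by (simp add: u_def field_simps)
    ultimately show "\<bar>s - t\<bar> \<le> 2 * r / m"
      using r mult_right_mono[of "\<bar>u s - u t\<bar>" 1 "2 * r / m"] by (simp add: abs_mult)
  qed
qed

lemma card_bounded_functions:
  "finite {h :: 'd::finite \<Rightarrow> nat. \<forall>i. h i < m}"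
  "card {h :: 'd::finite \<Rightarrow> nat. \<forall>i. h i < m} = m ^ CARD('d)"
proof -
  have eq: "{h :: 'd \<Rightarrow> nat. \<forall>i. h i < m} = PiE UNIV (\<lambda>_. {..<m})"
    by (auto simp: PiE_UNIV_domain Pi_def)
  show "finite {h :: 'd \<Rightarrow> nat. \<forall>i. h i < m}"
    unfolding eq by (rule finite_PiE) auto
  show "card {h :: 'd \<Rightarrow> nat. \<forall>i. h i < m} = m ^ CARD('d)"
    unfolding eq by (subst card_PiE) auto
qed

text \<open>The factor \<open>2\<close> lost by rounding \<open>k powr (1/d)\<close> down to an integer is what turns the
side \<open>2 * r\<close> of the cube into the constant \<open>4 * r\<close>.\<close>

lemma exists_small_cluster:
  fixes x :: "'a \<Rightarrow> real ^ 'd" and r :: real and c k :: nat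
  assumes "finite A" "card A = c * k" "k \<ge> 1" "r \<ge> 0" "\<And>i. i \<in> A \<Longrightarrow> infnorm (x i) \<le> r"
  shows "\<exists>S\<subseteq>A. card S = c \<and>
    (\<forall>i\<in>S. \<forall>j\<in>S. infnorm (x i - x j) \<le> 4 * r * real k powr (- 1 / real CARD('d)))"
proof -
  define t where "t = real k powr (1 / real CARD('d))"
  define m where "m = nat \<lfloor>t\<rfloor>"
  have t1: "t \<ge> 1"
    unfolding t_def using assms(3) by (intro ge_one_powr_ge_zero) auto
  then have "m \<ge> 1" "real m \<le> t" "t \<le> real m + 1"
    unfolding m_def by linarith+
  then have m: "m \<ge> 1" "real m \<le> t" "t \<le> 2 * real m"
    by linarith+
  have "real m ^ CARD('d) \<le> t ^ CARD('d)"
    using m by (intro power_mono) auto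
  also have "\<dots> = real k"
    using assms(3) by (simp add: t_def powr_realpow[symmetric] powr_powr)
  finally have mk: "m ^ CARD('d) \<le> k"
    by (metis of_nat_le_iff of_nat_power)
  obtain g where g: "\<And>s. g s < m"
    "\<And>s s'. \<bar>s\<bar> \<le> r \<Longrightarrow> \<bar>s'\<bar> \<le> r \<Longrightarrow> g s = g s' \<Longrightarrow> \<bar>s - s'\<bar> \<le> 2 * r / m"
    using interval_partition[OF assms(4) m(1)] by metis
  define B where "B = {h :: 'd \<Rightarrow> nat. \<forall>i. h i < m}"
  define cell where "cell a = (\<lambda>i. g (x a $ i))" for a
  have "c * card B \<le> card A"
    using mk by (simp add: B_def card_bounded_functions assms(2))
  moreover have "(\<lambda>_. 0) \<in> B" using m(1) by (simp add: B_def)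
  moreover have "finite B" "cell ` A \<subseteq> B"
    using g(1) by (auto simp: B_def cell_def card_bounded_functions)
  ultimately obtain b where "c \<le> card {a\<in>A. cell a = b}"
    using pigeonhole_fibre_card_ge[OF assms(1), of B cell c] by blast
  then obtain S where S: "S \<subseteq> {a\<in>A. cell a = b}" "card S = c"
    by (meson obtain_subset_with_card_n)
  have "infnorm (x i - x j) \<le> 4 * r * real k powr (- 1 / real CARD('d))"
    if ij: "i \<in> S" "j \<in> S" for i j
  proof -
    have "infnorm (x i - x j) \<le> 2 * r / m"
    proof (rule infnorm_le_cart)
      fix l
      have "\<bar>x a $ l\<bar> \<le> r" if "a \<in> A" for a
        using component_le_infnorm_cart[of "x a" l] assms(5)[OF that] by linarith
      moreover have "cell i = cell j" using ij S by auto
      then have "g (x i $ l) = g (x j $ l)" unfolding cell_def by metis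
      moreover have "i \<in> A" "j \<in> A" using ij S by auto
      ultimately show "\<bar>(x i - x j) $ l\<bar> \<le> 2 * r / m"
        using g(2)[of "x i $ l" "x j $ l"] by simp
    qed
    also have "\<dots> \<le> 4 * r / t"
    proof -
      have "2 * r * t \<le> 2 * r * (2 * m)"
        using m(3) assms(4) by (intro mult_left_mono) auto
      then show ?thesis using m(1) t1 by (simp add: field_simps)
    qed
    also have "\<dots> = 4 * r * real k powr (- 1 / real CARD('d))"
      by (simp add: t_def powr_minus_divide)
    finally show ?thesis .
  qed
  then show ?thesis using S by blast
qed

lemma Diam_le:
  assumes "A \<noteq> {}" "\<And>u v. u \<in> A \<Longrightarrow> v \<in> A \<Longrightarrow> infnorm (u - v) \<le> b"
  shows "Diam A \<le> b"
  unfolding Diam_def by (rule cSUP_least) (use assms in auto)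

section \<open>Power sums\<close>

text \<open>The induction step compares the term \<open>(n + 1) powr (-a)\<close> with the increment of
\<open>t powr (1 - a) / (1 - a)\<close>.  Multiplied by \<open>(n + 1) powr a\<close>, this is the weighted
arithmetic-geometric mean inequality for \<open>n\<close> and \<open>n + 1\<close> with weights \<open>1 - a\<close> and \<open>a\<close>.\<close>

lemma sum_powr_minus_le:
  fixes a :: real
  assumes "0 \<le> a" "a < 1"
  shows "(\<Sum>k=1..n. real k powr (- a)) \<le> real n powr (1 - a) / (1 - a)"
proof (induction n)
  case 0
  then show ?case by simp
next
  case (Suc n)
  define p where "p = real (Suc n) powr (- a)"
  have p: "p > 0" "real (Suc n) powr a * p = 1" "real (Suc n) powr (1 - a) = real (Suc n) * p"
    by (simp_all add: p_def powr_add[symmetric] powr_diff powr_minus_divide del: of_nat_Suc)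
  have "real n powr (1 - a) * real (Suc n) powr a \<le> (1 - a) * n + a * real (Suc n)"
  proof (cases "n = 0")
    case False
    then show ?thesis
      using assms by (intro Youngs_inequality_0) auto
  qed (use assms in simp)
  then have "real n powr (1 - a) * real (Suc n) powr a * p \<le> ((1 - a) * n + a * real (Suc n)) * p"
    using p(1) by (intro mult_right_mono) auto
  also have "real n powr (1 - a) * real (Suc n) powr a * p = real n powr (1 - a)"
    by (simp only: mult.assoc p(2) mult_1_right)
  also have "((1 - a) * n + a * real (Suc n)) * p = (n + a) * p"
    by (simp add: algebra_simps)
  finally have "real n powr (1 - a) \<le> (n + a) * p" .
  then have "real n powr (1 - a) + (1 - a) * p \<le> real (Suc n) powr (1 - a)"
    unfolding p(3) by (simp add: algebra_simps)
  then have "(real n powr (1 - a) + (1 - a) * p) / (1 - a) \<le> real (Suc n) powr (1 - a) / (1 - a)"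
    using assms(2) by (intro divide_right_mono) auto
  then have "real n powr (1 - a) / (1 - a) + p \<le> real (Suc n) powr (1 - a) / (1 - a)"
    using assms(2) by (simp add: add_divide_distrib)
  then show ?case using Suc.IH by (simp add: p_def)
qed

lemma sum_inverse_le_ln:
  assumes "n \<ge> 1"
  shows "(\<Sum>k=1..n. 1 / real k) \<le> 1 + ln (real n)"
  using assms
proof (induction n rule: dec_induct)
  case base
  then show ?case by simp
next
  case (step n)
  have "ln (real n / real (Suc n)) \<le> real n / real (Suc n) - 1"
    using step.hyps by (intro ln_le_minus_one) auto
  also have "\<dots> = - (1 / real (Suc n))" by (simp add: field_simps)
  finally have "1 / real (Suc n) \<le> ln (real (Suc n)) - ln (real n)"
    using step.hyps by (simp add: ln_div del: of_nat_Suc)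
  then show ?case using step.IH by simp
qed

lemma mean_powr_le_f1:
  assumes "d \<ge> 1" "n \<ge> 1"
  shows "(\<Sum>k=1..n. real k powr (- 1 / real d)) / real n \<le> f1 d n"
proof (cases "d = 1")
  case True
  have "(\<Sum>k=1..n. real k powr (- 1 / real d)) = (\<Sum>k=1..n. 1 / real k)"
    using True by (intro sum.cong) (auto simp: powr_minus_divide)
  then show ?thesis
    using sum_inverse_le_ln[OF assms(2)] True assms(2) by (simp add: f1_def divide_right_mono)
next
  case False
  with assms have d: "real d > 1" by simp
  have "(\<Sum>k=1..n. real k powr (- 1 / real d)) \<le> real n powr (1 - 1 / d) / (1 - 1 / d)"
    using sum_powr_minus_le[of "1 / d" n] d by simp
  also have "\<dots> = real n * (real d / (real d - 1) * real n powr (- 1 / real d))"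
  proof -
    have "1 / (1 - 1 / real d) = real d / (real d - 1)"
      using d by (simp add: field_simps)
    moreover have "real n powr (1 - 1 / d) = real n * real n powr (- 1 / real d)"
      using assms(2) by (simp add: powr_diff powr_minus_divide)
    ultimately show ?thesis
      by (metis (no_types) mult.left_commute mult.commute times_divide_eq_right mult.right_neutral)
  qed
  finally show ?thesis
    using False assms(2) by (simp add: f1_def divide_le_eq mult.commute)
qed

section \<open>The clustering theorem\<close>

theorem corollary3p6:
  fixes x :: "nat \<Rightarrow> real ^ 'd" and N c n :: nat and r :: real
  assumes "c \<ge> 1" and "n \<ge> 1" and "N = c * n"
    and "r = Max ((\<lambda>i. infnorm (x i)) ` {1..N})"
  shows "\<exists>C :: nat \<Rightarrow> nat set.
           (\<forall>k\<in>{1..n}. C k \<subseteq> {1..N}) \<and>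
           disjoint_family_on C {1..n} \<and>
           (\<forall>k\<in>{1..n}. card (C k) = c) \<and>
           (\<forall>k\<in>{1..n}. Diam (x ` C k) \<le> 4 * r * real k powr (- 1 / real CARD('d))) \<and>
           (\<exists>(xbar :: nat \<Rightarrow> real ^ 'd) (\<kappa> :: nat \<Rightarrow> nat).
              (\<forall>i\<in>{1..N}. \<kappa> i \<in> {1..n} \<and> i \<in> C (\<kappa> i)) \<and>
              1 / real N * (\<Sum>i=1..N. infnorm (x i - xbar (\<kappa> i))) \<le> 4 * r * f1 CARD('d) n)"
proof -
  define D where "D k = 4 * r * real k powr (- 1 / real CARD('d))" for k :: nat
  have norm_le: "infnorm (x i) \<le> r" if "i \<in> {1..N}" for i
    unfolding assms(4) using that by (intro Max_ge) auto
  have "1 \<in> {1..N}" using assms(1-3) by simp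
  then have r: "r \<ge> 0"
    using norm_le infnorm_pos_le order_trans by blast
  have cluster: "\<exists>S\<subseteq>A. card S = c \<and> (\<forall>i\<in>S. \<forall>j\<in>S. infnorm (x i - x j) \<le> D k)"
    if "k \<in> {1..n}" "A \<subseteq> {1..N}" "finite A" "card A = c * k" for k A
    unfolding D_def using that r norm_le by (intro exists_small_cluster) auto
  have "\<exists>C. (\<forall>k\<in>{1..n}. C k \<subseteq> {1..N} \<and> card (C k) = c \<and>
                (\<forall>i\<in>C k. \<forall>j\<in>C k. infnorm (x i - x j) \<le> D k)) \<and> disjoint_family_on C {1..n}"
    using assms(3) by (intro greedy_disjoint_family cluster) auto
  then obtain C where clusters: "\<forall>k\<in>{1..n}. C k \<subseteq> {1..N} \<and> card (C k) = c \<and>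
      (\<forall>i\<in>C k. \<forall>j\<in>C k. infnorm (x i - x j) \<le> D k)" and disj: "disjoint_family_on C {1..n}"
    by blast
  have C: "C k \<subseteq> {1..N}" "card (C k) = c"
      "i \<in> C k \<Longrightarrow> j \<in> C k \<Longrightarrow> infnorm (x i - x j) \<le> D k" if "k \<in> {1..n}" for k i j
    using bspec[OF clusters that] by auto
  have fin: "finite (C k)" and ne: "C k \<noteq> {}" if "k \<in> {1..n}" for k
    using C(2)[OF that] assms(1) card_gt_0_iff[of "C k"] by auto
  have diam: "Diam (x ` C k) \<le> D k" if "k \<in> {1..n}" for k
    using ne[OF that] C(3)[OF that] by (intro Diam_le) auto
  have "card (\<Union>k\<in>{1..n}. C k) = (\<Sum>k\<in>{1..n}. card (C k))"
    using fin disj by (intro card_UN_disjoint) (auto dest: disjoint_family_onD)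
  also have "\<dots> = card {1..N}"
    using C(2) assms(3) by (simp add: mult.commute)
  finally have cover: "(\<Union>k\<in>{1..n}. C k) = {1..N}"
    by (intro card_subset_eq[OF _ UN_least[OF C(1)]]) auto
  then have "\<forall>i\<in>{1..N}. \<exists>k. k \<in> {1..n} \<and> i \<in> C k" by blast
  then obtain \<kappa> where \<kappa>: "\<forall>i\<in>{1..N}. \<kappa> i \<in> {1..n} \<and> i \<in> C (\<kappa> i)"
    by metis
  define xbar where "xbar k = x (SOME i. i \<in> C k)" for k
  have near: "infnorm (x i - xbar k) \<le> D k" if "k \<in> {1..n}" "i \<in> C k" for i k
    unfolding xbar_def by (rule C(3)[OF that someI[of "\<lambda>i. i \<in> C k", OF that(2)]])
  have \<kappa>_eq: "\<kappa> i = k" if "k \<in> {1..n}" "i \<in> C k" for i k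
  proof -
    have "i \<in> {1..N}" using C(1)[OF that(1)] that(2) by blast
    with \<kappa> have "\<kappa> i \<in> {1..n}" "i \<in> C (\<kappa> i)" by auto
    then show ?thesis
      using disjoint_family_onD[OF disj that(1), of "\<kappa> i"] that(2) by blast
  qed
  have "(\<Sum>i=1..N. infnorm (x i - xbar (\<kappa> i)))
      = (\<Sum>k=1..n. \<Sum>i\<in>C k. infnorm (x i - xbar (\<kappa> i)))"
    unfolding cover[symmetric] using fin disj
    by (intro sum.UNION_disjoint) (auto dest: disjoint_family_onD)
  also have "\<dots> \<le> (\<Sum>k=1..n. \<Sum>i\<in>C k. D k)"
    using near \<kappa>_eq by (intro sum_mono) auto
  also have "\<dots> = real c * (4 * r) * (\<Sum>k=1..n. real k powr (- 1 / real CARD('d)))"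
    using C(2) by (simp add: D_def sum_distrib_left mult.assoc)
  finally have "1 / real N * (\<Sum>i=1..N. infnorm (x i - xbar (\<kappa> i)))
      \<le> 1 / real N * (real c * (4 * r) * (\<Sum>k=1..n. real k powr (- 1 / real CARD('d))))"
    by (intro mult_left_mono) auto
  also have "\<dots> = 4 * r * ((\<Sum>k=1..n. real k powr (- 1 / real CARD('d))) / real n)"
    using assms(1-3) by simp
  also have "\<dots> \<le> 4 * r * f1 CARD('d) n"
    using r assms(2) by (intro mult_left_mono mean_powr_le_f1) (auto simp: Suc_leI)
  finally have mean:
    "1 / real N * (\<Sum>i=1..N. infnorm (x i - xbar (\<kappa> i))) \<le> 4 * r * f1 CARD('d) n" .
  show ?thesis
    using C(1,2) disj diam \<kappa> mean unfolding D_def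
    by (intro exI[of _ C] exI[of _ xbar] exI[of _ \<kappa>] conjI ballI) simp_all
qed

end
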